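(* Let $\Gamma=a_1\Gamma_1+a_2\Gamma_2$ be a gluing of numerical semigroups. Suppose there exists a real number $y\geq \mathrm m(\Gamma_1)$ such that $\#\operatorname{Ap}(\Gamma_1,z)\geq \mathrm m(\Gamma_1)\left\lceil\frac{z}{y}\right\rceil$ for all $z\in\mathbb{Z}$. If $a_2>a_1y$, then $$\#\operatorname{Ap}(\Gamma,z)\geq \mathrm m(\Gamma)\left\lceil \frac{z}{a_2}\right\rceil\quad\text{for all } z\in\mathbb{Z}.$$
   Context: $\mathbb N$ denotes the non-negative integers. A numerical semigroup is a set $\langle n_1,\dots,n_m\rangle:=n_1\mathbb N+\cdots+n_m\mathbb N$ with $n_i$ positive integers and $\gcd(n_1,\dots,n_m)=1$. The minimal generators of $\Gamma$ are the elements of its unique minimal generating set. The multiplicity $\mathrm m(\Gamma)$ is the smallest positive element of $\Gamma$. For $x\in\mathbb Z$, the Apéry set is $\operatorname{Ap}(\Gamma,x)=\{a\in\Gamma\mid a-x\notin\Gamma\}$. Gluing: given numerical semigroups $\Gamma_1,\Gamma_2$, $a_1\in\Gamma_2$ and $a_2\in\Gamma_1$ with $\gcd(a_1,a_2)=1$, $a_1$ not a minimal generator of $\Gamma_2$ and $a_2$ not a minimal generator of $\Gamma_1$, the numerical semigroup $a_1\Gamma_1+a_2\Gamma_2$ is called a gluing of $\Gamma_1$ and $\Gamma_2$. *)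

theory Defs
  imports Complex_Main
begin

(* <n_1,...,n_m> = n_1 N + ... + n_m N; only meant for finite A, since the sum over an
   infinite A is 0 by convention. *)
definition generated :: "nat set \<Rightarrow> nat set" where
  "generated A = {\<Sum>a\<in>A. c a * a | c :: nat \<Rightarrow> nat. True}"

(* Gcd {} = 0, so A is necessarily nonempty. *)
definition numerical_semigroup :: "nat set \<Rightarrow> bool" where
  "numerical_semigroup S \<longleftrightarrow>
     (\<exists>A. finite A \<and> (\<forall>a\<in>A. 0 < a) \<and> Gcd A = 1 \<and> S = generated A)"

definition minimal_generating_set :: "nat set \<Rightarrow> nat set \<Rightarrow> bool" where
  "minimal_generating_set S A \<longleftrightarrow>
     finite A \<and> generated A = S \<and> (\<forall>B. B \<subset> A \<longrightarrow> generated B \<noteq> S)"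

(* A numerical semigroup has exactly one minimal generating set, so the existential
   quantifier refers to that set. *)
definition minimal_generator :: "nat set \<Rightarrow> nat \<Rightarrow> bool" where
  "minimal_generator S x \<longleftrightarrow> (\<exists>A. minimal_generating_set S A \<and> x \<in> A)"

definition sg_multiplicity :: "nat set \<Rightarrow> nat" where
  "sg_multiplicity S = (LEAST x. x \<in> S \<and> 0 < x)"

(* The difference a - x is taken in the integers, as x may be negative or exceed a. *)
definition Apery :: "nat set \<Rightarrow> int \<Rightarrow> nat set" where
  "Apery S x = {a \<in> S. int a - x \<notin> int ` S}"

definition is_gluing :: "nat set \<Rightarrow> nat \<Rightarrow> nat set \<Rightarrow> nat \<Rightarrow> nat set \<Rightarrow> bool" where
  "is_gluing S a1 S1 a2 S2 \<longleftrightarrow>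
     numerical_semigroup S1 \<and> numerical_semigroup S2 \<and>
     a1 \<in> S2 \<and> a2 \<in> S1 \<and> gcd a1 a2 = 1 \<and>
     \<not> minimal_generator S2 a1 \<and> \<not> minimal_generator S1 a2 \<and>
     S = {a1 * s + a2 * t | s t. s \<in> S1 \<and> t \<in> S2}"

end

theory Submission
  imports Defs "HOL-Number_Theory.Cong"
begin

text \<open>
  Every integer is uniquely \<open>a1 * x + a2 * w\<close> with \<open>w\<close> the least element of \<open>S2\<close> in its class
  modulo \<open>a1\<close>, and it lies in \<open>S\<close> iff \<open>x \<in> S1\<close>. Subtracting \<open>z\<close> permutes the residue classes, so
  \<open>Apery S z\<close> splits into copies of \<open>Apery S1 n\<close>, one for each class, where
  \<open>n = (z + a2 * (w' - w)) / a1\<close> and \<open>w'\<close> belongs to the shifted class. Since \<open>a2 > a1 * y\<close>, the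
  hypothesis bounds the size of each copy below by \<open>m(S1) * (\<lceil>z / a2\<rceil> + w' - w)\<close>, and the
  differences \<open>w' - w\<close> cancel in the sum over all classes.
\<close>

section \<open>Monoid structure of generated sets\<close>

lemma zero_in_generated: "0 \<in> generated A"
  unfolding generated_def by (auto intro: exI[of _ "\<lambda>_. 0"])

lemma add_in_generated:
  assumes "s \<in> generated A" and "t \<in> generated A"
  shows "s + t \<in> generated A"
proof -
  obtain c d where "s = (\<Sum>a\<in>A. c a * a)" "t = (\<Sum>a\<in>A. d a * a)"
    using assms unfolding generated_def by blast
  then have "s + t = (\<Sum>a\<in>A. (c a + d a) * a)"
    by (simp add: sum.distrib add_mult_distrib)
  then show ?thesis
    unfolding generated_def by (auto intro!: exI[of _ "\<lambda>a. c a + d a"])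
qed

lemma subset_generated:
  assumes "finite A"
  shows "A \<subseteq> generated A"
proof
  fix x assume "x \<in> A"
  have "(\<Sum>a\<in>A. (if a = x then 1 else 0) * a) = (\<Sum>a\<in>A. if a = x then a else 0)"
    by (rule sum.cong) auto
  also have "\<dots> = x"
    using \<open>x \<in> A\<close> assms by simp
  finally show "x \<in> generated A"
    unfolding generated_def by (auto intro!: exI[of _ "\<lambda>a. if a = x then 1 else 0"])
qed

text \<open>For a submonoid \<open>S\<close> containing \<open>a > 0\<close>, these values over all
  classes \<open>i\<close> form the Apery set of \<open>S\<close> with respect to \<open>a\<close>.
  The index is an integer so that classes can be shifted in either direction.\<close>

definition least_cong :: "nat set \<Rightarrow> nat \<Rightarrow> int \<Rightarrow> nat" where
  "least_cong S a i = (LEAST t. t \<in> S \<and> [int t = i] (mod int a))"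

section \<open>Submonoids of the naturals with gcd 1\<close>

locale coprime_submonoid =
  fixes S :: "nat set"
  assumes zero: "0 \<in> S"
    and add: "s \<in> S \<Longrightarrow> t \<in> S \<Longrightarrow> s + t \<in> S"
    and Gcd_eq_1: "Gcd S = 1"
begin

lemma mult: "s \<in> S \<Longrightarrow> k * s \<in> S"
  by (induction k) (auto intro: zero add)

lemma obtain_pos:
  obtains s where "s \<in> S" and "0 < s"
proof -
  have "\<not> S \<subseteq> {0}"
    using Gcd_eq_1 Gcd_0_iff[of S] by simp
  then show thesis
    using that by blast
qed

text \<open>The least positive difference \<open>d\<close> of two elements divides every element, so \<open>d = 1\<close>.\<close>

lemma consecutive:
  obtains x where "x \<in> S" and "Suc x \<in> S"
proof -
  define P where "P d \<longleftrightarrow> 0 < d \<and> (\<exists>x\<in>S. x + d \<in> S)" for d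
  define d where "d = (LEAST d. P d)"
  obtain s where "s \<in> S" "0 < s"
    by (rule obtain_pos)
  then have "P s"
    unfolding P_def using zero by (auto intro!: bexI[of _ 0])
  then have Pd: "P d"
    unfolding d_def by (rule LeastI)
  then obtain x where x: "x \<in> S" "x + d \<in> S" and "0 < d"
    unfolding P_def by blast
  have "d dvd s" if "s \<in> S" for s
  proof (rule ccontr)
    assume "\<not> d dvd s"
    then have pos: "0 < s mod d"
      by (simp add: dvd_eq_mod_eq_0)
    let ?k = "s div d"
    \<comment> \<open>Both \<open>?k * (x + d)\<close> and \<open>s + ?k * x\<close> lie in
      \<open>S\<close>, so \<open>s mod d\<close> would be a positive difference smaller than
      \<open>d\<close>.\<close>
    have "?k * (x + d) + s mod d = s + ?k * x"
      by (simp add: algebra_simps)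
    moreover have "s + ?k * x \<in> S" "?k * (x + d) \<in> S"
      using add mult x that by auto
    ultimately have "P (s mod d)"
      unfolding P_def using pos by metis
    then have "d \<le> s mod d"
      unfolding d_def by (rule Least_le)
    then show False
      using \<open>0 < d\<close> mod_less_divisor[of d s] by linarith
  qed
  then have "d dvd Gcd S"
    by (rule Gcd_greatest)
  then show thesis
    using that x Gcd_eq_1 by simp
qed

text \<open>For consecutive elements \<open>x\<close> and \<open>x + 1\<close>, division with
  remainder \<open>n = q * x + r\<close> rewrites as \<open>(q - r) * x + r * (x + 1)\<close>. The
  coefficient \<open>q - r\<close> is legitimate once \<open>r \<le> q\<close>, which
  \<open>n \<ge> x * x\<close> guarantees.\<close>

lemma eventually_mem: "\<exists>N. \<forall>n\<ge>N. n \<in> S"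
proof -
  obtain x where x: "x \<in> S" "Suc x \<in> S"
    using consecutive by blast
  have "n \<in> S" if "n \<ge> x * x" for n
  proof (cases "x = 0")
    case True
    then show ?thesis
      using mult[OF x(2), of n] by simp
  next
    case False
    let ?q = "n div x" and ?r = "n mod x"
    have "?r \<le> x"
      using False by (simp add: less_imp_le)
    moreover have "x \<le> ?q"
      using that False by (metis div_le_mono nonzero_mult_div_cancel_right)
    ultimately have le: "?r \<le> ?q"
      by simp
    have "(?q - ?r) * x + ?r * Suc x = (?q - ?r + ?r) * x + ?r"
      by (simp add: algebra_simps del: le_add_diff_inverse2)
    also have "\<dots> = n"
      using le by simp
    finally show ?thesis
      using add mult x by metis
  qed
  then show ?thesis
    by blast
qed

text \<open>For large \<open>a\<close> the difference \<open>a - z\<close> is itself in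
  \<open>S\<close>. Finiteness matters because \<open>card\<close> of an infinite set is 0.\<close>

lemma finite_Apery: "finite (Apery S z)"
proof -
  obtain N where N: "\<And>n. n \<ge> N \<Longrightarrow> n \<in> S"
    using eventually_mem by blast
  have "Apery S z \<subseteq> {..nat (int N + z)}"
  proof
    fix a assume a: "a \<in> Apery S z"
    show "a \<in> {..nat (int N + z)}"
    proof (rule ccontr)
      assume "a \<notin> {..nat (int N + z)}"
      then have "int a - z = int (nat (int a - z))" "nat (int a - z) \<in> S"
        by (auto intro!: N)
      then show False
        using a unfolding Apery_def by (metis (no_types, lifting) CollectD imageI)
    qed
  qed
  then show ?thesis
    by (rule finite_subset) simp
qed

lemma sg_multiplicity: "sg_multiplicity S \<in> S \<and> 0 < sg_multiplicity S"
proof -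
  obtain s where "s \<in> S \<and> 0 < s"
    using obtain_pos by blast
  then show ?thesis
    unfolding sg_multiplicity_def by (rule LeastI)
qed

lemma least_cong:
  assumes "0 < a"
  shows "least_cong S a i \<in> S \<and> [int (least_cong S a i) = i] (mod int a)"
proof -
  obtain N where N: "\<And>n. n \<ge> N \<Longrightarrow> n \<in> S"
    using eventually_mem by blast
  \<comment> \<open>Multiples of \<open>a\<close> preserve the class, and \<open>N\<close> of them
    reach beyond \<open>N\<close>.\<close>
  let ?t = "nat (i mod int a) + N * a"
  have "N \<le> ?t"
    using assms by (cases a) auto
  then have "?t \<in> S"
    by (rule N)
  moreover have "[int ?t = i] (mod int a)"
    using assms by (simp add: cong_def)
  ultimately have "?t \<in> S \<and> [int ?t = i] (mod int a)" ..
  then show ?thesis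
    unfolding least_cong_def by (rule LeastI)
qed

end

section \<open>Numerical semigroups and their generators\<close>

lemma numerical_semigroup_coprime_submonoid:
  assumes "numerical_semigroup S"
  shows "coprime_submonoid S"
proof -
  obtain A where A: "finite A" "Gcd A = 1" "S = generated A"
    using assms unfolding numerical_semigroup_def by blast
  have "Gcd S dvd Gcd A"
    using subset_generated[OF A(1)] A(3) by (intro Gcd_greatest Gcd_dvd) blast
  then show ?thesis
    using A by unfold_locales (auto intro: zero_in_generated add_in_generated)
qed

text \<open>Serves to exclude degenerate gluings: containing 1 makes \<open>S\<close> all of the
  naturals, with minimal generating set \<open>{1}\<close>.\<close>

lemma minimal_generator_1:
  assumes "numerical_semigroup S" and "1 \<in> S"
  shows "minimal_generator S 1"
proof -
  interpret coprime_submonoid S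
    using assms(1) by (rule numerical_semigroup_coprime_submonoid)
  have "n \<in> S" for n
    using mult[OF assms(2), of n] by simp
  moreover have "n \<in> generated {1}" for n
    unfolding generated_def by (auto intro: exI[of _ "\<lambda>_. n"])
  ultimately have eq: "generated {1} = S"
    by blast
  have "generated {} = {0}"
    unfolding generated_def by simp
  then have "generated {} \<noteq> S"
    using assms(2) by auto
  then have "minimal_generating_set S {1}"
    unfolding minimal_generating_set_def using eq by (metis finite.emptyI finite.insertI subset_singletonD psubset_eq)
  then show ?thesis
    unfolding minimal_generator_def by blast
qed

section \<open>Periodic sums and ceilings\<close>

lemma sum_periodic_shift:
  fixes f :: "int \<Rightarrow> 'a :: comm_monoid_add"
  assumes "0 < a" and per: "\<And>i j. [i = j] (mod a) \<Longrightarrow> f i = f j"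
  shows "(\<Sum>i\<in>{0..<a}. f (i + k)) = (\<Sum>i\<in>{0..<a}. f i)"
proof -
  have "bij_betw (\<lambda>i. (i + k) mod a) {0..<a} {0..<a}"
  proof (rule bij_betw_byWitness[where f' = "\<lambda>i. (i - k) mod a"])
    show "\<forall>i\<in>{0..<a}. ((i + k) mod a - k) mod a = i"
      by (simp add: mod_diff_left_eq)
    show "\<forall>i\<in>{0..<a}. ((i - k) mod a + k) mod a = i"
      by (simp add: mod_add_left_eq)
  qed (use assms(1) in auto)
  then have "(\<Sum>i\<in>{0..<a}. f ((i + k) mod a)) = (\<Sum>i\<in>{0..<a}. f i)"
    by (rule sum.reindex_bij_betw)
  moreover have "f ((i + k) mod a) = f (i + k)" for i
    by (rule per) simp
  ultimately show ?thesis
    by simp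
qed

text \<open>Scaling by \<open>c \<ge> 1\<close> does not decrease a nonnegative
  \<open>x + d\<close>, and the integer \<open>d\<close> leaves the ceiling. For negative
  \<open>x + d\<close> the right side is at most 0, which the \<open>max\<close> absorbs.\<close>

lemma ceiling_mult_ge:
  fixes c x :: real and d :: int
  assumes "c \<ge> 1"
  shows "max 0 \<lceil>c * (x + d)\<rceil> \<ge> \<lceil>x\<rceil> + d"
proof (cases "x + d \<ge> 0")
  case True
  then have "1 * (x + d) \<le> c * (x + d)"
    by (intro mult_right_mono assms)
  then have "\<lceil>x + d\<rceil> \<le> \<lceil>c * (x + d)\<rceil>"
    by (intro ceiling_mono) simp
  then show ?thesis
    by simp
next
  case False
  then have "\<lceil>x + d\<rceil> \<le> 0"
    by (subst ceiling_le_zero) linarith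
  then show ?thesis
    by simp
qed

section \<open>Least elements of residue classes, and gluings\<close>

lemma least_cong_le:
  assumes "t \<in> S" and "[int t = i] (mod int a)"
  shows "least_cong S a i \<le> t"
  unfolding least_cong_def by (rule Least_le) (use assms in simp)

lemma least_cong_periodic:
  assumes "[i = j] (mod int a)"
  shows "least_cong S a i = least_cong S a j"
proof -
  have "[t = i] (mod int a) \<longleftrightarrow> [t = j] (mod int a)" for t
    using assms cong_trans cong_sym by blast
  then show ?thesis
    unfolding least_cong_def by simp
qed

text \<open>Compare with a decomposition \<open>n = a1 * s + a2 * t\<close>. Coprimality puts
  \<open>t\<close> in the class of the least element \<open>w\<close>, and minimality gives
  \<open>t = w + a1 * k\<close> with \<open>k\<close> natural. Hence \<open>x = s + k * a2\<close>,
  which is in \<open>S1\<close> because \<open>a2\<close> is.\<close>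

lemma gluing_membership:
  fixes x :: int
  assumes gluing: "is_gluing S a1 S1 a2 S2" and "0 < a1"
    and mem: "int n = int a1 * x + int a2 * int (least_cong S2 a1 i)" "n \<in> S"
  shows "x \<in> int ` S1"
proof -
  have a2: "a2 \<in> S1" and cop: "coprime a1 a2"
    using gluing unfolding is_gluing_def by (auto simp: coprime_iff_gcd_eq_1)
  interpret S1: coprime_submonoid S1
    using gluing numerical_semigroup_coprime_submonoid unfolding is_gluing_def by blast
  interpret S2: coprime_submonoid S2
    using gluing numerical_semigroup_coprime_submonoid unfolding is_gluing_def by blast
  let ?w = "least_cong S2 a1 i"
  obtain s t where st: "n = a1 * s + a2 * t" "s \<in> S1" "t \<in> S2"
    using gluing mem(2) unfolding is_gluing_def by blast
  have eq: "int a2 * (int t - int ?w) = int a1 * (x - int s)"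
    using mem(1) st(1) by (simp add: algebra_simps)
  then have "int a1 dvd int a2 * (int t - int ?w)"
    by simp
  then have dvd: "int a1 dvd int t - int ?w"
    using cop by (subst (asm) coprime_dvd_mult_right_iff) auto
  then have "[int t = int ?w] (mod int a1)"
    by (simp add: cong_iff_dvd_diff)
  then have "[int t = i] (mod int a1)"
    using S2.least_cong[OF \<open>0 < a1\<close>] cong_trans by blast
  then have "?w \<le> t"
    using st(3) by (intro least_cong_le)
  then have "int a1 dvd int (t - ?w)"
    using dvd by (simp add: of_nat_diff)
  then obtain k where k: "t - ?w = a1 * k"
    by (auto simp: int_dvd_int_iff)
  then have "int t - int ?w = int a1 * int k"
    using \<open>?w \<le> t\<close> by (metis of_nat_diff of_nat_mult)
  then have "int a1 * (int a2 * int k) = int a1 * (x - int s)"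
    using eq by (simp add: mult.left_commute)
  then have "x = int (s + k * a2)"
    using \<open>0 < a1\<close> by (simp add: mult.commute)
  then show ?thesis
    using S1.add[OF st(2) S1.mult[OF a2]] by blast
qed

text \<open>\<open>Gcd S\<close> divides every \<open>a1 * s\<close> with \<open>s \<in> S1\<close>,
  hence \<open>a1\<close> since \<open>Gcd S1 = 1\<close>; likewise it divides
  \<open>a2\<close>.\<close>

lemma gluing_coprime_submonoid:
  assumes "is_gluing S a1 S1 a2 S2"
  shows "coprime_submonoid S"
proof
  have S: "S = {a1 * s + a2 * t | s t. s \<in> S1 \<and> t \<in> S2}"
    and S12: "numerical_semigroup S1" "numerical_semigroup S2" and gcd: "gcd a1 a2 = 1"
    using assms unfolding is_gluing_def by auto
  interpret S1: coprime_submonoid S1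
    using S12(1) by (rule numerical_semigroup_coprime_submonoid)
  interpret S2: coprime_submonoid S2
    using S12(2) by (rule numerical_semigroup_coprime_submonoid)
  show "0 \<in> S"
    unfolding S using S1.zero S2.zero by force
  show "s + t \<in> S" if st: "s \<in> S" "t \<in> S" for s t
  proof -
    obtain s1 t1 s2 t2 where "s = a1 * s1 + a2 * t1" "t = a1 * s2 + a2 * t2"
      and mem: "s1 \<in> S1" "s2 \<in> S1" "t1 \<in> S2" "t2 \<in> S2"
      using st unfolding S by blast
    then have "s + t = a1 * (s1 + s2) + a2 * (t1 + t2)"
      by (simp add: algebra_simps)
    then show ?thesis
      unfolding S using mem S1.add S2.add by blast
  qed
  have "Gcd S dvd a1 * s" if "s \<in> S1" for s
  proof (rule Gcd_dvd)
    show "a1 * s \<in> S"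
      unfolding S using that S2.zero by force
  qed
  then have "Gcd S dvd Gcd ((*) a1 ` S1)"
    by (intro Gcd_greatest) auto
  then have d1: "Gcd S dvd a1"
    using S1.Gcd_eq_1 by (simp add: Gcd_mult)
  have "Gcd S dvd a2 * t" if "t \<in> S2" for t
  proof (rule Gcd_dvd)
    show "a2 * t \<in> S"
      unfolding S using that S1.zero by force
  qed
  then have "Gcd S dvd Gcd ((*) a2 ` S2)"
    by (intro Gcd_greatest) auto
  then have "Gcd S dvd a2"
    using S2.Gcd_eq_1 by (simp add: Gcd_mult)
  with d1 have "Gcd S dvd gcd a1 a2"
    by simp
  then show "Gcd S = 1"
    using gcd by simp
qed

text \<open>If \<open>a1 = 0\<close>, the gcd condition forces \<open>a2 = 1\<close>, which would be
  a minimal generator of \<open>S1\<close>.\<close>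

lemma gluing_a1_pos:
  assumes "is_gluing S a1 S1 a2 S2"
  shows "0 < a1"
proof (rule ccontr)
  assume "\<not> 0 < a1"
  then have "a2 = 1"
    using assms unfolding is_gluing_def by simp
  then show False
    using assms minimal_generator_1 unfolding is_gluing_def by auto
qed

lemma sg_multiplicity_gluing_le:
  assumes "is_gluing S a1 S1 a2 S2"
  shows "sg_multiplicity S \<le> a1 * sg_multiplicity S1"
proof -
  have S: "S = {a1 * s + a2 * t | s t. s \<in> S1 \<and> t \<in> S2}"
    and S12: "numerical_semigroup S1" "numerical_semigroup S2"
    using assms unfolding is_gluing_def by auto
  interpret S1: coprime_submonoid S1
    using S12(1) by (rule numerical_semigroup_coprime_submonoid)
  interpret S2: coprime_submonoid S2
    using S12(2) by (rule numerical_semigroup_coprime_submonoid)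
  have "a1 * sg_multiplicity S1 \<in> S"
    unfolding S using S1.sg_multiplicity S2.zero by force
  then show ?thesis
    unfolding sg_multiplicity_def[of S]
    using S1.sg_multiplicity gluing_a1_pos[OF assms] by (intro Least_le) simp
qed

text \<open>Elements \<open>a1 * u + a2 * w i\<close> have class \<open>a2 * i\<close> modulo
  \<open>a1\<close>, so the condition on \<open>k\<close> says that subtracting \<open>z\<close>
  sends index \<open>i\<close> to \<open>i + k\<close>. The sum is bounded by embedding the disjoint
  union of the sets \<open>Apery S1 (n i)\<close> into \<open>Apery S z\<close>.\<close>

lemma sum_card_Apery_le:
  fixes z k :: int
  assumes gluing: "is_gluing S a1 S1 a2 S2" and k: "[int a2 * k = - z] (mod int a1)"
  defines "w \<equiv> \<lambda>i. int (least_cong S2 a1 i)"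
  obtains n where "\<And>i. int a1 * n i = z + int a2 * (w (i + k) - w i)"
    and "(\<Sum>i\<in>{0..<int a1}. card (Apery S1 (n i))) \<le> card (Apery S z)"
proof -
  let ?I = "{0..<int a1}"
  define n where "n i = (z + int a2 * (w (i + k) - w i)) div int a1" for i
  have S: "S = {a1 * s + a2 * t | s t. s \<in> S1 \<and> t \<in> S2}"
    and S12: "numerical_semigroup S1" "numerical_semigroup S2" and cop: "coprime a1 a2"
    using gluing unfolding is_gluing_def by (auto simp: coprime_iff_gcd_eq_1)
  note a1 = gluing_a1_pos[OF gluing]
  interpret S1: coprime_submonoid S1
    using S12(1) by (rule numerical_semigroup_coprime_submonoid)
  interpret S2: coprime_submonoid S2
    using S12(2) by (rule numerical_semigroup_coprime_submonoid)
  interpret S: coprime_submonoid S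
    using gluing by (rule gluing_coprime_submonoid)
  have wS2: "least_cong S2 a1 i \<in> S2" and wcong: "[w i = i] (mod int a1)" for i
    unfolding w_def using S2.least_cong[OF a1] by auto
  have n: "int a1 * n i = z + int a2 * (w (i + k) - w i)" for i
  proof -
    \<comment> \<open>The division defining \<open>n i\<close> is exact: modulo \<open>a1\<close>
      each \<open>w\<close> may be replaced by its index, leaving \<open>z + a2 * k\<close>, which
      vanishes.\<close>
    have "[z + int a2 * (w (i + k) - w i) = z + int a2 * ((i + k) - i)] (mod int a1)"
      by (intro cong_add cong_mult cong_diff cong_refl wcong)
    also have "[z + int a2 * ((i + k) - i) = z + - z] (mod int a1)"
      using cong_add[OF cong_refl[of z] k] by (simp add: algebra_simps)
    finally have "int a1 dvd z + int a2 * (w (i + k) - w i)"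
      by (simp add: cong_0_iff)
    then show ?thesis
      unfolding n_def by simp
  qed
  define \<phi> where "\<phi> = (\<lambda>(i, u). a1 * u + a2 * least_cong S2 a1 i)"
  have "inj_on \<phi> (SIGMA i:?I. Apery S1 (n i))"
  proof (rule inj_onI, clarify)
    fix i u j v
    assume ij: "i \<in> ?I" "j \<in> ?I" and "\<phi> (i, u) = \<phi> (j, v)"
    then have "int (a1 * u + a2 * least_cong S2 a1 i) = int (a1 * v + a2 * least_cong S2 a1 j)"
      unfolding \<phi>_def by simp
    then have eq: "int a2 * (w i - w j) = int a1 * (int v - int u)"
      unfolding w_def by (simp add: algebra_simps)
    then have "int a1 dvd int a2 * (w i - w j)"
      by simp
    then have "int a1 dvd w i - w j"
      using cop by (subst (asm) coprime_dvd_mult_right_iff) auto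
    then have "[w i = w j] (mod int a1)"
      by (simp add: cong_iff_dvd_diff)
    then have "[i = j] (mod int a1)"
      using wcong cong_trans cong_sym by meson
    then have "i = j"
      using ij by (simp add: cong_def)
    with eq a1 show "i = j \<and> u = v"
      by simp
  qed
  moreover have "\<phi> ` (SIGMA i:?I. Apery S1 (n i)) \<subseteq> Apery S z"
  proof clarify
    fix i u assume u: "u \<in> Apery S1 (n i)"
    \<comment> \<open>Subtracting \<open>z\<close> gives the normal form for index
      \<open>i + k\<close> with first coordinate \<open>u - n i\<close>, so membership in
      \<open>S\<close> would force \<open>u - n i\<close> into \<open>S1\<close>.\<close>
    have eq: "int (\<phi> (i, u)) - z = int a1 * (int u - n i) + int a2 * w (i + k)"
      unfolding \<phi>_def w_def right_diff_distrib n by (simp add: w_def algebra_simps)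
    have "\<phi> (i, u) \<in> S"
      unfolding \<phi>_def S using u wS2 by (auto simp: Apery_def)
    moreover have "int (\<phi> (i, u)) - z \<notin> int ` S"
    proof
      assume "int (\<phi> (i, u)) - z \<in> int ` S"
      then obtain s where "s \<in> S" "int s = int a1 * (int u - n i) + int a2 * w (i + k)"
        unfolding eq by auto
      then have "int u - n i \<in> int ` S1"
        using gluing_membership[OF gluing a1] unfolding w_def by blast
      then show False
        using u unfolding Apery_def by simp
    qed
    ultimately show "\<phi> (i, u) \<in> Apery S z"
      unfolding Apery_def by simp
  qed
  ultimately have "card (SIGMA i:?I. Apery S1 (n i)) \<le> card (Apery S z)"
    by (rule card_inj_on_le) (rule S.finite_Apery)
  moreover have "card (SIGMA i:?I. Apery S1 (n i)) = (\<Sum>i\<in>?I. card (Apery S1 (n i)))"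
    using S1.finite_Apery by (intro card_SigmaI) auto
  ultimately show thesis
    using that[of n] n by simp
qed

theorem theorem15:
  fixes S S1 S2 :: "nat set" and a1 a2 :: nat and y :: real
  assumes "is_gluing S a1 S1 a2 S2"
    and "y \<ge> real (sg_multiplicity S1)"
    and "\<And>z :: int. int (card (Apery S1 z)) \<ge> int (sg_multiplicity S1) * \<lceil>real_of_int z / y\<rceil>"
    and "real a2 > real a1 * y"
  shows "\<forall>z :: int. int (card (Apery S z)) \<ge> int (sg_multiplicity S) * \<lceil>real_of_int z / real a2\<rceil>"
proof
  fix z :: int
  let ?I = "{0..<int a1}" and ?m1 = "int (sg_multiplicity S1)"
  let ?c = "\<lceil>real_of_int z / real a2\<rceil>"
  note a1 = gluing_a1_pos[OF assms(1)]
  have cop: "coprime a1 a2"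
    using assms(1) unfolding is_gluing_def by (auto simp: coprime_iff_gcd_eq_1)
  interpret S1: coprime_submonoid S1
    using assms(1) numerical_semigroup_coprime_submonoid unfolding is_gluing_def by blast
  have y: "0 < y"
    using S1.sg_multiplicity assms(2) by linarith
  have a1y: "0 < real a1 * y"
    using a1 y by simp
  have a2: "0 < real a2"
    using a1y assms(4) by linarith
  define w where "w i = int (least_cong S2 a1 i)" for i
  show "int (card (Apery S z)) \<ge> int (sg_multiplicity S) * ?c"
  \<comment> \<open>For \<open>z \<le> 0\<close> the claimed bound is nonpositive. For positive
    \<open>z\<close> the ceiling is nonnegative, so \<open>m(S) \<le> a1 * m(S1)\<close> may later
    be multiplied by it.\<close>
  proof (cases "z \<le> 0")
    case True
    then have "?c \<le> 0"
      using a2 by (simp add: divide_nonpos_pos)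
    then have "int (sg_multiplicity S) * ?c \<le> 0"
      by (intro mult_nonneg_nonpos) auto
    then show ?thesis
      by linarith
  next
    case False
    then have c: "?c \<ge> 0"
      using a2 by (simp add: less_le_trans[of "-1" 0])
    have "coprime (int a2) (int a1)"
      using cop by (simp add: coprime_commute)
    \<comment> \<open>An inverse \<open>b\<close> of \<open>a2\<close> modulo \<open>a1\<close>
      yields the shift \<open>k = - b * z\<close>.\<close>
    then obtain b where "[int a2 * b = 1] (mod int a1)"
      using cong_solve_coprime_int by blast
    then have "[int a2 * b * (- z) = 1 * (- z)] (mod int a1)"
      by (rule cong_mult) simp
    then obtain k where k: "[int a2 * k = - z] (mod int a1)"
      by (metis mult.assoc mult_1)
    obtain n where n: "\<And>i. int a1 * n i = z + int a2 * (w (i + k) - w i)"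
      and card: "(\<Sum>i\<in>?I. card (Apery S1 (n i))) \<le> card (Apery S z)"
      using sum_card_Apery_le[OF assms(1) k] unfolding w_def by blast
    have bound: "int (card (Apery S1 (n i))) \<ge> ?m1 * (?c + (w (i + k) - w i))" for i
    proof -
      define d where "d = w (i + k) - w i"
      have "real a1 * real_of_int (n i) = real_of_int (int a1 * n i)"
        by simp
      also have "\<dots> = z + real a2 * d"
        unfolding n d_def by simp
      finally have "real_of_int (n i) = (z + real a2 * d) / real a1"
        using a1 by (simp add: field_simps)
      then have "real_of_int (n i) / y = (z + real a2 * d) / real a1 / y"
        by simp
      \<comment> \<open>This isolates the factor \<open>a2 / (a1 * y)\<close>, which exceeds 1 by
        the assumption on \<open>a2\<close>, in front of \<open>z / a2\<close> plus the integer
        \<open>d\<close>.\<close>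
      also have "\<dots> = real a2 / (real a1 * y) * (z / real a2 + d)"
        using a1 y a2 by (simp add: field_simps)
      finally have "real_of_int (n i) / y = real a2 / (real a1 * y) * (z / real a2 + d)" .
      moreover have "real a2 / (real a1 * y) \<ge> 1"
        using a1y assms(4) by simp
      ultimately have "?c + d \<le> max 0 \<lceil>real_of_int (n i) / y\<rceil>"
        using ceiling_mult_ge by metis
      then have "?m1 * (?c + d) \<le> ?m1 * max 0 \<lceil>real_of_int (n i) / y\<rceil>"
        by (intro mult_left_mono) auto
      \<comment> \<open>The hypothesis covers the ceiling, and nonnegativity of \<open>card\<close>
        covers the 0 in the \<open>max\<close>.\<close>
      also have "\<dots> \<le> int (card (Apery S1 (n i)))"
        using assms(3)[of "n i"] by (auto simp: max_def)
      finally show ?thesis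
        unfolding d_def .
    qed
    \<comment> \<open>\<open>w\<close> depends only on the class modulo \<open>a1\<close>, so the
      shift permutes its values and the differences cancel, leaving \<open>?m1 * ?c\<close> for each
      of the \<open>a1\<close> classes.\<close>
    have "(\<Sum>i\<in>?I. w (i + k)) = (\<Sum>i\<in>?I. w i)"
      using a1 unfolding w_def
      by (intro sum_periodic_shift) (auto intro: least_cong_periodic)
    then have "(\<Sum>i\<in>?I. ?m1 * (?c + (w (i + k) - w i))) = int a1 * ?m1 * ?c"
      by (simp add: sum_distrib_left[symmetric] sum.distrib sum_subtractf)
    moreover have "(\<Sum>i\<in>?I. ?m1 * (?c + (w (i + k) - w i))) \<le> (\<Sum>i\<in>?I. int (card (Apery S1 (n i))))"
      by (intro sum_mono bound)
    moreover have "(\<Sum>i\<in>?I. int (card (Apery S1 (n i)))) \<le> int (card (Apery S z))"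
      using card by (simp flip: of_nat_sum)
    moreover have "int (sg_multiplicity S) * ?c \<le> int (a1 * sg_multiplicity S1) * ?c"
      using sg_multiplicity_gluing_le[OF assms(1)] c by (intro mult_right_mono) (simp only: of_nat_le_iff)
    ultimately show ?thesis
      by simp
  qed
qed

end
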